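(* Let $A$ be a finite set with $|A|\geq 2$, let $\theta\in(0,1)$, let $\phi:A^{\mathbb{N}}\to\mathbb{R}$ be Lipschitz with respect to $d_\theta$, and let $\mu_\phi$ be its Gibbs measure. Let $D=D(\phi)>0$ be a constant such that for every integer $n\geq 1$ and every separately Lipschitz function $K:\Omega^n\to\mathbb{R}$, $$\int e^{K(\underline{x},\ldots,\sigma^{n-1}\underline{x})}\,d\mu_\phi(\underline{x})\leq e^{\int K(\underline{y},\ldots,\sigma^{n-1}\underline{y})\,d\mu_\phi(\underline{y})}\;e^{D\sum_{i=0}^{n-1}\mathrm{Lip}_i(K)^2}.$$ Then for every $\alpha\in(0,1)$, every $t>0$, every integer $n\geq 2$ and every integer $k(n)\geq 1$ with $k(n)\leq \frac{\alpha}{2\log|A|}\log n$, one has $$\mu_\phi\left\{\left| \frac{\widehat{H}_{k(n)}}{k(n)} -\mathbb{E}\left(\frac{\widehat{H}_{k(n)}}{k(n)}\right)\right|\geq t \right\} \leq 2\exp\left(-\frac{n^{1-\alpha}t^{2}}{16D(\log n)^2} \right)$$ and $$\mathrm{Var}\left(\frac{\widehat{H}_{k(n)}}{k(n)}\right) \leq 8D\, \frac{(\log n)^2}{n^{1-\alpha}}.$$ Here $\widehat{H}_{k(n)}=\widehat{H}_{k(n)}(x_0^{n-1})$ is the $k(n)$-block empirical entropy of the first $n$ symbols of $\underline{x}$, and $\mathbb{E}$ and $\mathrm{Var}$ denote expectation and variance under $\mu_\phi$.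
   Context: $\Omega=A^{\mathbb{N}}$ is the set of sequences $\underline{x}=x_0,x_1,\ldots$ with $x_j\in A$, and $\sigma$ is the shift, $(\sigma\underline{x})_i=x_{i+1}$. For $\underline{x}\neq\underline{y}$, $d_\theta(\underline{x},\underline{y})=\theta^N$, where $N$ is the largest nonnegative integer with $x_i=y_i$ for all $0\leq i<N$; $d_\theta(\underline{x},\underline{x})=0$. Gibbs measure: for $\phi$ Lipschitz with respect to $d_\theta$, $\mu_\phi$ is the unique shift-invariant probability measure on $\Omega$ for which there exist constants $C>1$ and $P\in\mathbb{R}$ such that $$C^{-1}\leq \frac{\mu_\phi(\{\underline{y}: y_i=x_i,\ 0\leq i<m\})}{\exp\left(-Pm+\sum_{k=0}^{m-1}\phi(\sigma^k\underline{x})\right)}\leq C$$ for all $\underline{x}\in\Omega$ and $m\geq 1$. For $K:\Omega^n\to\mathbb{R}$ and $0\leq j\leq n-1$, $\mathrm{Lip}_j(K)$ is the supremum of $|K(\underline{x}^{(0)},\ldots,\underline{x}^{(n-1)})-K(\underline{x}^{(0)},\ldots,\underline{x}^{(j-1)},\underline{y}^{(j)},\underline{x}^{(j+1)},\ldots,\underline{x}^{(n-1)})|/d_\theta(\underline{x}^{(j)},\underline{y}^{(j)})$ over all $\underline{x}^{(0)},\ldots,\underline{x}^{(n-1)}\in\Omega$ and all $\underline{y}^{(j)}\neq\underline{x}^{(j)}$. $K$ is separately Lipschitz if $\mathrm{Lip}_j(K)<\infty$ for all $j$. A constant $D$ as in the claim is known to exist for every Gibbs measure $\mu_\phi$. Empirical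 frequencies: for $x_0^{n-1}=x_0,\ldots,x_{n-1}$, let $\tilde{\underline{x}}=x_0^{n-1}x_0^{n-1}\cdots$ be its $n$-periodic extension. For $k\geq 1$ and $a_0^{k-1}\in A^k$ let $$\mathcal{E}_k(a_0^{k-1};x_0^{n-1})=\frac1n\#\{0\leq j\leq n-1:\ \tilde{x}_j^{j+k-1}=a_0^{k-1}\},$$ which is a probability measure on $A^k$. The $k$-block empirical entropy is $$\widehat{H}_k(x_0^{n-1})=-\sum_{a_0^{k-1}\in A^k}\mathcal{E}_k(a_0^{k-1};x_0^{n-1})\log\mathcal{E}_k(a_0^{k-1};x_0^{n-1}),$$ with $0\log 0=0$. *)

theory Defs
  imports "HOL-Probability.Probability"
begin

text \<open>The alphabet \<open>A\<close> is a type of class \<^class>\<open>finite\<close>; \<open>\<Omega> = A\<^sup>\<nat>\<close> is \<open>nat \<Rightarrow> 'a\<close>.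
  Elements of \<open>\<Omega>\<^sup>n\<close> and of \<open>A\<^sup>k\<close> are lists of length \<open>n\<close> and \<open>k\<close>.\<close>

definition shift :: "(nat \<Rightarrow> 'a) \<Rightarrow> nat \<Rightarrow> 'a" where
  "shift x = (\<lambda>i. x (Suc i))"

definition d_theta :: "real \<Rightarrow> (nat \<Rightarrow> 'a) \<Rightarrow> (nat \<Rightarrow> 'a) \<Rightarrow> real" where
  "d_theta \<theta> x y = (if x = y then 0 else \<theta> ^ (GREATEST N. \<forall>i<N. x i = y i))"

definition lipschitz_d_theta :: "real \<Rightarrow> ((nat \<Rightarrow> 'a) \<Rightarrow> real) \<Rightarrow> bool" where
  "lipschitz_d_theta \<theta> \<phi> \<longleftrightarrow> (\<exists>L. \<forall>x y. \<bar>\<phi> x - \<phi> y\<bar> \<le> L * d_theta \<theta> x y)"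

text \<open>Product of the discrete sigma-algebras. As the alphabet is finite, this is the
  Borel sigma-algebra of \<open>d\<^sub>\<theta>\<close> for every \<open>\<theta>\<close> in \<open>(0, 1)\<close>.\<close>

definition sequence_space :: "(nat \<Rightarrow> 'a) measure" where
  "sequence_space = (\<Pi>\<^sub>M i\<in>UNIV. count_space UNIV)"

text \<open>For Lipschitz \<open>\<phi>\<close> exactly one measure satisfies this predicate; existence and
  uniqueness are not part of the definition.\<close>

definition is_gibbs_measure :: "((nat \<Rightarrow> 'a) \<Rightarrow> real) \<Rightarrow> (nat \<Rightarrow> 'a) measure \<Rightarrow> bool" where
  "is_gibbs_measure \<phi> \<mu> \<longleftrightarrow>
     prob_space \<mu> \<and> sets \<mu> = sets sequence_space \<and> distr \<mu> \<mu> shift = \<mu> \<and>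
     (\<exists>C P. C > 1 \<and>
       (\<forall>x. \<forall>m\<ge>1.
          1 / C \<le> measure \<mu> {y. \<forall>i<m. y i = x i} /
                  exp (- P * real m + (\<Sum>k<m. \<phi> ((shift ^^ k) x))) \<and>
          measure \<mu> {y. \<forall>i<m. y i = x i} /
                  exp (- P * real m + (\<Sum>k<m. \<phi> ((shift ^^ k) x))) \<le> C))"

text \<open>\<open>K\<close> is a function on \<open>\<Omega>\<^sup>n\<close>: only its values at lists of length \<open>n\<close> matter.\<close>

definition Lip :: "real \<Rightarrow> nat \<Rightarrow> nat \<Rightarrow> ((nat \<Rightarrow> 'a) list \<Rightarrow> real) \<Rightarrow> ennreal" where
  "Lip \<theta> n j K =
     (SUP (xs, y) \<in> {(xs, y). length xs = n \<and> y \<noteq> xs ! j}.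
        ennreal (\<bar>K xs - K (xs[j := y])\<bar> / d_theta \<theta> (xs ! j) y))"

definition separately_lipschitz :: "real \<Rightarrow> nat \<Rightarrow> ((nat \<Rightarrow> 'a) list \<Rightarrow> real) \<Rightarrow> bool" where
  "separately_lipschitz \<theta> n K \<longleftrightarrow> (\<forall>j<n. Lip \<theta> n j K < \<infinity>)"

definition orbit_segment :: "nat \<Rightarrow> (nat \<Rightarrow> 'a) \<Rightarrow> (nat \<Rightarrow> 'a) list" where
  "orbit_segment n x = map (\<lambda>i. (shift ^^ i) x) [0..<n]"

definition periodic_extension :: "'a list \<Rightarrow> nat \<Rightarrow> 'a" where
  "periodic_extension xs = (\<lambda>i. xs ! (i mod length xs))"

definition empirical_freq :: "nat \<Rightarrow> 'a list \<Rightarrow> 'a list \<Rightarrow> real" where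
  "empirical_freq k a xs =
     real (card {j. j < length xs \<and> map (\<lambda>i. periodic_extension xs (j + i)) [0..<k] = a})
       / real (length xs)"

definition empirical_entropy :: "nat \<Rightarrow> 'a::finite list \<Rightarrow> real" where
  "empirical_entropy k xs =
     - (\<Sum>a | length a = k. empirical_freq k a xs * ln (empirical_freq k a xs))"

end

theory Submission
  imports Defs "HOL-Real_Asymp.Real_Asymp"
begin

text \<open>The function \<open>h(p) = - p ln p\<close> satisfies \<open>\<bar>h(c / n) - h(c' / n)\<bar> \<le> \<bar>c - c'\<bar> ln n / n\<close> on
  integers \<open>0 \<le> c, c' \<le> n\<close>. Changing one letter of a cyclic word of length \<open>n\<close> changes at most
  \<open>k\<close> windows of length \<open>k\<close>, hence the block counts by at most \<open>2k\<close> in total, so the empirical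
  entropy divided by \<open>k\<close>, viewed as a function of the first letters of the \<open>n\<close> shifted sequences,
  has all Lipschitz constants at most \<open>2 ln n / n\<close>. Applied to its multiples by \<open>s\<close>, the
  exponential inequality gives \<open>E exp(s (X - E X)) \<le> exp(V s\<^sup>2)\<close> with
  \<open>V = 4 D (ln n)\<^sup>2 / n\<close>. Optimizing the Chernoff bound over \<open>s\<close> gives the tail, and letting
  \<open>s \<rightarrow> 0\<close> the variance; the claim follows from \<open>n powr (1 - \<alpha>) \<le> n\<close>.\<close>

section \<open>Elementary inequalities for \<open>cosh\<close> and for \<open>c ln c\<close> on
  integers\<close>

text \<open>The half-angle formula reduces this to
  \<open>\<bar>u\<bar> \<le> \<bar>sinh u\<bar>\<close>.\<close>

lemma cosh_ge_quadratic: "1 + x\<^sup>2 / 2 \<le> cosh (x::real)"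
proof -
  have "\<bar>x / 2\<bar> \<le> \<bar>sinh (x / 2)\<bar>"
    using real_le_abs_sinh[of "x / 2"] by (simp add: sinh_field_def exp_minus)
  then have "(x / 2)\<^sup>2 \<le> (sinh (x / 2))\<^sup>2"
    by (simp only: abs_le_square_iff)
  moreover have "cosh x = 1 + 2 * (sinh (x / 2))\<^sup>2"
    using cosh_double[of "x / 2"] cosh_square_eq[of "x / 2"] by simp
  ultimately show ?thesis
    by (simp add: power_divide)
qed

text \<open>The increment splits as \<open>ln (c + 1) + c * (ln (c + 1) - ln c)\<close>, both parts
  at most \<open>ln n\<close>. The interval from \<open>0\<close> to \<open>2 ln n\<close> is
  centred at \<open>ln n\<close>, the amount that the normalization \<open>c / n\<close> subtracts
  per unit step.\<close>

lemma nat_mult_ln_diff_bounds: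
  assumes "Suc c \<le> n"
  shows "0 \<le> real (Suc c) * ln (real (Suc c)) - real c * ln (real c)"
    and "real (Suc c) * ln (real (Suc c)) - real c * ln (real c) \<le> 2 * ln (real n)"
proof -
  show "0 \<le> real (Suc c) * ln (real (Suc c)) - real c * ln (real c)"
  proof (cases "c = 0")
    case False
    then have "real c * ln (real c) \<le> real (Suc c) * ln (real (Suc c))"
      by (intro mult_mono) auto
    then show ?thesis by simp
  qed simp
  show "real (Suc c) * ln (real (Suc c)) - real c * ln (real c) \<le> 2 * ln (real n)"
  proof (cases "c = 0")
    case True
    then show ?thesis using assms by simp
  next
    case False
    then have c: "c \<ge> 1" by simp
    have le: "ln (real (Suc c)) \<le> ln (real n)"
      using assms by simp
    have "real c * (ln (real (Suc c)) - ln (real c)) \<le> ln (real n)"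
    \<comment> \<open>The estimate by \<open>1\<close> used for \<open>c \<ge> 2\<close> needs
      \<open>n \<ge> 3 > e\<close>. For \<open>c = 1\<close>, where \<open>n = 2\<close> is
      possible, the left side is exactly \<open>ln 2\<close>.\<close>
    proof (cases "c = 1")
      case True
      then show ?thesis using le by simp
    next
      case c1: False
      have "ln (real (Suc c)) - ln (real c) = ln (1 + 1 / real c)"
      proof -
        have "1 + 1 / real c = real (Suc c) / real c"
          using c by (simp add: field_simps)
        then show ?thesis
          using c by (simp add: ln_div)
      qed
      also have "\<dots> \<le> 1 / real c"
        by (rule ln_add_one_self_le_self) simp
      finally have "real c * (ln (real (Suc c)) - ln (real c)) \<le> 1"
        using c by (simp add: field_simps)
      also have "1 \<le> ln (real n)"
      proof -
        have "exp 1 \<le> real n"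
          using exp_le c1 c assms by linarith
        then show ?thesis
          using assms by (subst ln_ge_iff) auto
      qed
      finally show ?thesis .
    qed
    with le show ?thesis
      by (simp add: algebra_simps)
  qed
qed

text \<open>Each term equals \<open>(c ln c - c ln n) / n\<close>. Unit steps of its numerator have
  absolute value at most \<open>ln n\<close>, and they are summed by induction from the smaller
  count to the larger.\<close>

lemma entropy_term_lipschitz:
  assumes "c \<le> n" "c' \<le> n"
  shows "\<bar>real c / real n * ln (real c / real n) - real c' / real n * ln (real c' / real n)\<bar>
    \<le> ln (real n) / real n * \<bar>real c - real c'\<bar>"
proof (cases "n = 0")
  case n: False
  define F where "F c = real c * ln (real c) - real c * ln (real n)" for c :: nat
  have F: "real c / real n * ln (real c / real n) = F c / real n" for c
    using n by (cases "c = 0") (auto simp: F_def ln_div field_simps)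
  have mono: "\<bar>F a - F b\<bar> \<le> ln (real n) * (real b - real a)" if "a \<le> b" "b \<le> n" for a b
    using that
  proof (induction b rule: dec_induct)
    case (step b)
    have "\<bar>F (Suc b) - F b\<bar> \<le> ln (real n)"
      using nat_mult_ln_diff_bounds[of b n] step.prems
      by (simp add: F_def algebra_simps abs_le_iff)
    moreover have "\<bar>F a - F b\<bar> \<le> ln (real n) * (real b - real a)"
      using step by simp
    ultimately show ?case
      by (simp add: algebra_simps)
  qed simp
  have "\<bar>F c - F c'\<bar> \<le> ln (real n) * \<bar>real c - real c'\<bar>"
  proof (cases "c \<le> c'")
    case True
    then show ?thesis using mono[of c c'] assms by simp
  next
    case False
    then show ?thesis using mono[of c' c] assms by simp
  qed
  then have "\<bar>F c - F c'\<bar> / real n \<le> ln (real n) * \<bar>real c - real c'\<bar> / real n"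
    by (rule divide_right_mono) simp
  then show ?thesis
    unfolding F by (simp add: diff_divide_distrib[symmetric])
qed simp

section \<open>Effect of changing one letter on block counts and empirical entropy\<close>

text \<open>Indices outside \<open>J\<close> cancel. An index in \<open>J\<close> affects at most
  two values of \<open>b\<close>, namely \<open>w j\<close> and \<open>w' j\<close>, which gives the
  factor 2.\<close>

lemma sum_card_fibres_diff_le:
  fixes w w' :: "'i \<Rightarrow> 'b"
  assumes I: "finite I" and B: "finite B" and J: "J \<subseteq> I"
    and same: "\<And>j. j \<in> I - J \<Longrightarrow> w j = w' j"
  shows "(\<Sum>b\<in>B. \<bar>real (card {j \<in> I. w j = b}) - real (card {j \<in> I. w' j = b})\<bar>) \<le> 2 * card J"
proof -
  have finJ: "finite J" using J I by (rule finite_subset)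
  have card_eq: "real (card {j \<in> I. v j = b}) = (\<Sum>j\<in>I. of_bool (v j = b))" for v :: "'i \<Rightarrow> 'b" and b
    using I by (simp add: Int_def)
  have "\<bar>real (card {j \<in> I. w j = b}) - real (card {j \<in> I. w' j = b})\<bar>
      \<le> (\<Sum>j\<in>J. of_bool (w j = b) + of_bool (w' j = b))" for b
  proof -
    have "real (card {j \<in> I. w j = b}) - real (card {j \<in> I. w' j = b})
        = (\<Sum>j\<in>I. of_bool (w j = b) - of_bool (w' j = b))"
      unfolding card_eq by (simp only: sum_subtractf)
    also have "\<dots> = (\<Sum>j\<in>J. of_bool (w j = b) - of_bool (w' j = b))"
      using I J same by (intro sum.mono_neutral_right) auto
    also have "\<bar>\<dots>\<bar> \<le> (\<Sum>j\<in>J. of_bool (w j = b) + of_bool (w' j = b))"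
      by (rule order_trans[OF sum_abs sum_mono]) auto
    finally show ?thesis .
  qed
  then have "(\<Sum>b\<in>B. \<bar>real (card {j \<in> I. w j = b}) - real (card {j \<in> I. w' j = b})\<bar>)
      \<le> (\<Sum>b\<in>B. \<Sum>j\<in>J. of_bool (w j = b) + of_bool (w' j = b))"
    by (rule sum_mono)
  also have "\<dots> = (\<Sum>j\<in>J. \<Sum>b\<in>B. of_bool (w j = b) + of_bool (w' j = b))"
    by (rule sum.swap)
  also have "\<dots> \<le> (\<Sum>j\<in>J. 2)"
  proof (rule sum_mono)
    fix j
    have "(\<Sum>b\<in>B. of_bool (v = b)) \<le> (1::real)" for v
      using B by (simp add: of_bool_def sum.delta')
    from add_mono[OF this[of "w j"] this[of "w' j"]]
    show "(\<Sum>b\<in>B. of_bool (w j = b) + of_bool (w' j = b)) \<le> (2::real)"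
      by (simp add: sum.distrib)
  qed
  finally show ?thesis by simp
qed

text \<open>For each of the \<open>k\<close> offsets \<open>l\<close>, the rotation by
  \<open>l\<close> is injective modulo \<open>n\<close>, so at most one starting point
  \<open>j\<close> reaches position \<open>i\<close>.\<close>

lemma card_cyclic_windows_le:
  "card {j. j < n \<and> (\<exists>l<k. (j + l) mod n = i)} \<le> k"
proof -
  have "{j. j < n \<and> (\<exists>l<k. (j + l) mod n = i)} = (\<Union>l<k. {j. j < n \<and> (j + l) mod n = i})"
    by auto
  also have "card \<dots> \<le> (\<Sum>l<k. card {j. j < n \<and> (j + l) mod n = i})"
    by (rule card_UN_le) simp
  also have "\<dots> \<le> (\<Sum>l<k. 1)"
  proof (rule sum_mono)
    fix l
    have eq_of_le: "j = j'" if "j \<le> j'" "j' < n" "(j + l) mod n = (j' + l) mod n" for j j'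
    proof -
      have "n dvd j' - j"
        using that mod_eq_dvd_iff_nat[of "j + l" "j' + l" n] by simp
      then show ?thesis
        using that by (auto dest: dvd_imp_le)
    qed
    have "j = j'" if "j < n" "j' < n" "(j + l) mod n = (j' + l) mod n" for j j'
      using eq_of_le[of j j'] eq_of_le[of j' j] that by (cases "j \<le> j'") auto
    then show "card {j. j < n \<and> (j + l) mod n = i} \<le> 1"
      by (auto simp: card_le_Suc0_iff_eq)
  qed
  finally show ?thesis by simp
qed

lemma empirical_entropy_update:
  fixes ls :: "'a::finite list"
  assumes "i < length ls"
  shows "\<bar>empirical_entropy k ls - empirical_entropy k (ls[i := a])\<bar>
    \<le> 2 * real k * ln (real (length ls)) / real (length ls)"
proof -
  define n where "n = length ls"
  define w where "w xs j = map (\<lambda>l. periodic_extension xs (j + l)) [0..<k]" for xs :: "'a list" and j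
  define cnt where "cnt xs b = card {j \<in> {..<n}. w xs j = b}" for xs b
  define J where "J = {j. j < n \<and> (\<exists>l<k. (j + l) mod n = i)}"
  define B where "B = {b :: 'a list. length b = k}"
  have n: "n > 0" using assms by (auto simp: n_def)
  have finB: "finite B"
    using finite_lists_length_eq[of "UNIV :: 'a set" k] by (simp add: B_def)
  have ent: "empirical_entropy k xs
      = - (\<Sum>b\<in>B. real (cnt xs b) / real n * ln (real (cnt xs b) / real n))" if "length xs = n" for xs
    using that by (simp add: empirical_entropy_def empirical_freq_def cnt_def w_def B_def)
  have cnt_le: "cnt xs b \<le> n" for xs b
    unfolding cnt_def by (rule order_trans[OF card_mono[of "{..<n}"]]) auto
  have same: "w ls j = w (ls[i := a]) j" if "j \<in> {..<n} - J" for j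
    using that n by (auto simp: w_def periodic_extension_def J_def n_def)
  have "\<bar>empirical_entropy k ls - empirical_entropy k (ls[i := a])\<bar>
      = \<bar>\<Sum>b\<in>B. real (cnt ls b) / real n * ln (real (cnt ls b) / real n)
          - real (cnt (ls[i := a]) b) / real n * ln (real (cnt (ls[i := a]) b) / real n)\<bar>"
    by (simp add: ent n_def[symmetric] sum_subtractf)
  also have "\<dots> \<le> (\<Sum>b\<in>B. ln (real n) / real n * \<bar>real (cnt ls b) - real (cnt (ls[i := a]) b)\<bar>)"
    by (rule order_trans[OF sum_abs sum_mono[OF entropy_term_lipschitz[OF cnt_le cnt_le]]])
  also have "\<dots> = ln (real n) / real n * (\<Sum>b\<in>B. \<bar>real (cnt ls b) - real (cnt (ls[i := a]) b)\<bar>)"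
    by (simp add: sum_distrib_left)
  also have "\<dots> \<le> ln (real n) / real n * (2 * real k)"
  proof (rule mult_left_mono)
    have "(\<Sum>b\<in>B. \<bar>real (cnt ls b) - real (cnt (ls[i := a]) b)\<bar>) \<le> 2 * card J"
      unfolding cnt_def using finB same
      by (intro sum_card_fibres_diff_le) (auto simp: J_def)
    also have "card J \<le> k"
      unfolding J_def by (rule card_cyclic_windows_le)
    finally show "(\<Sum>b\<in>B. \<bar>real (cnt ls b) - real (cnt (ls[i := a]) b)\<bar>) \<le> 2 * real k"
      by simp
  qed (use n in simp)
  finally show ?thesis
    by (simp add: n_def mult.commute)
qed

section \<open>Lipschitz constants of functions of the leading letters\<close>

lemma d_theta_head_neq:
  assumes "x 0 \<noteq> y 0"
  shows "d_theta \<theta> x y = 1"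
proof -
  have "(GREATEST N. \<forall>i<N. x i = y i) = 0"
    using assms by (intro Greatest_equality) (auto simp: not_le intro: ccontr)
  then show ?thesis
    using assms by (auto simp: d_theta_def)
qed

text \<open>Replacing a sequence either keeps its leading letter, and the numerator vanishes, or
  moves it by distance exactly 1. The bound is therefore independent of \<theta>.\<close>

lemma Lip_head_le:
  fixes f :: "'a list \<Rightarrow> real"
  assumes "j < n"
    and "\<And>ls a. length ls = n \<Longrightarrow> \<bar>f ls - f (ls[j := a])\<bar> \<le> c"
  shows "Lip \<theta> n j (\<lambda>xs. f (map (\<lambda>x. x 0) xs)) \<le> ennreal c"
  unfolding Lip_def
proof (rule SUP_least, clarsimp)
  fix xs :: "(nat \<Rightarrow> 'a) list" and y :: "nat \<Rightarrow> 'a"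
  assume n: "n = length xs"
  let ?ls = "map (\<lambda>x. x 0) xs"
  have le: "\<bar>f ?ls - f (?ls[j := y 0])\<bar> \<le> c"
    using assms(2)[of ?ls] n by simp
  have upd: "map (\<lambda>x. x 0) (xs[j := y]) = ?ls[j := y 0]"
    by (rule map_update)
  show "ennreal (\<bar>f ?ls - f (map (\<lambda>x. x 0) (xs[j := y]))\<bar> / d_theta \<theta> (xs ! j) y) \<le> ennreal c"
  proof (cases "(xs ! j) 0 = y 0")
    case True
    then have "?ls[j := y 0] = ?ls"
      using assms(1) n by (metis list_update_id nth_map)
    then show ?thesis unfolding upd by simp
  next
    case False
    then show ?thesis
      unfolding upd using le by (simp add: d_theta_head_neq ennreal_leI)
  qed
qed

section \<open>Orbit segments and measurability of initial words\<close>

lemma funpow_shift: "(shift ^^ i) x = (\<lambda>j. x (i + j))"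
  by (induction i) (auto simp: shift_def)

lemma map_head_orbit_segment: "map (\<lambda>x. x 0) (orbit_segment n x) = map x [0..<n]"
  by (simp add: orbit_segment_def funpow_shift)

text \<open>There are countably many words over a finite alphabet, so preimages of single words
  suffice; these are cylinders, or empty if the length is wrong.\<close>

lemma measurable_initial_word:
  assumes "sets M = sets (sequence_space :: (nat \<Rightarrow> 'a::finite) measure)"
  shows "(\<lambda>x. map x [0..<n]) \<in> measurable M (count_space UNIV)"
proof -
  have coord: "(\<lambda>x. x i) \<in> measurable M (count_space UNIV)" for i
    using measurable_component_singleton[of i UNIV "\<lambda>_. count_space (UNIV :: 'a set)"]
    by (simp add: measurable_cong_sets[OF assms refl] sequence_space_def)
  have "{x \<in> space M. map x [0..<n] = l} \<in> sets M" for l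
  proof (cases "length l = n")
    case True
    then have "{x \<in> space M. map x [0..<n] = l} = {x \<in> space M. \<forall>i<n. x i = l ! i}"
      by (auto simp: list_eq_iff_nth_eq)
    also have "\<dots> \<in> sets M"
      using coord by measurable
    finally show ?thesis .
  next
    case False
    then have "{x \<in> space M. map x [0..<n] = l} = {}"
      by auto
    then show ?thesis by (simp only: sets.empty_sets)
  qed
  then show ?thesis
    by (subst measurable_count_space_eq2_countable) (auto simp: vimage_def Int_def conj_commute)
qed

section \<open>Tail and variance from a sub-Gaussian exponential moment bound\<close>

context prob_space
begin

context
  fixes X :: "'a \<Rightarrow> real" and B V :: real
  assumes X: "X \<in> borel_measurable M"
    and bounded: "\<And>x. \<bar>X x\<bar> \<le> B"
    and mgf: "\<And>s. expectation (\<lambda>x. exp (s * X x)) \<le> exp (s * expectation X) * exp (V * s\<^sup>2)"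
begin

text \<open>The integral of a non-integrable function is 0 by convention, so \<open>mgf\<close>
  alone would not control the exponential moments; boundedness of \<open>X\<close> supplies
  integrability.\<close>

lemma integrable_exp_mult_bounded: "integrable M (\<lambda>x. exp (s * X x))"
proof (rule integrable_const_bound)
  have "s * X x \<le> \<bar>s\<bar> * B" for x
    using mult_left_mono[OF bounded[of x], of "\<bar>s\<bar>"] abs_le_D1[of "s * X x"]
    by (simp add: abs_mult)
  then show "AE x in M. norm (exp (s * X x)) \<le> exp (\<bar>s\<bar> * B)"
    by simp
qed (use X in measurable)

lemma expectation_exp_centered:
  "integrable M (\<lambda>x. exp (s * (X x - expectation X)))"
  "expectation (\<lambda>x. exp (s * (X x - expectation X))) \<le> exp (V * s\<^sup>2)"
proof -
  have eq: "exp (s * (X x - expectation X)) = exp (s * X x) * exp (- (s * expectation X))" for x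
    by (simp add: exp_add[symmetric] algebra_simps)
  show "integrable M (\<lambda>x. exp (s * (X x - expectation X)))"
    unfolding eq using integrable_exp_mult_bounded by simp
  have "expectation (\<lambda>x. exp (s * (X x - expectation X)))
      = expectation (\<lambda>x. exp (s * X x)) * exp (- (s * expectation X))"
    unfolding eq by simp
  also have "\<dots> \<le> exp (s * expectation X) * exp (V * s\<^sup>2) * exp (- (s * expectation X))"
    by (intro mult_right_mono mgf) simp
  also have "\<dots> = exp (V * s\<^sup>2)"
    by (simp add: exp_add[symmetric])
  finally show "expectation (\<lambda>x. exp (s * (X x - expectation X))) \<le> exp (V * s\<^sup>2)" .
qed

lemma subgaussian_tail:
  assumes "V > 0" "t > 0"
  shows "prob {x \<in> space M. \<bar>X x - expectation X\<bar> \<ge> t} \<le> 2 * exp (- (t\<^sup>2 / (4 * V)))"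
proof -
  let ?Y = "\<lambda>x. X x - expectation X"
  \<comment> \<open>This choice minimizes the Chernoff exponent \<open>V * s^2 - s * t\<close>, with
    minimum \<open>- t^2 / (4 * V)\<close>.\<close>
  define s where "s = t / (2 * V)"
  have s: "s > 0" using assms by (simp add: s_def)
  have opt: "exp (- s * t) * exp (V * s\<^sup>2) = exp (- (t\<^sup>2 / (4 * V)))"
    using assms by (simp add: s_def exp_add[symmetric] power2_eq_square field_simps)
  \<comment> \<open>The sign \<open>r\<close> treats both tails at once, since the moment bound
    depends only on the square of \<open>s * r\<close>.\<close>
  have ge: "prob {x \<in> space M. r * ?Y x \<ge> t} \<le> exp (- (t\<^sup>2 / (4 * V)))" if "r\<^sup>2 = 1" for r
  proof -
    have "prob {x \<in> space M. r * ?Y x \<ge> t} \<le> exp (- s * t) * expectation (\<lambda>x. exp (s * (r * ?Y x)))"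
      using Chernoff_ineq_ge[OF s, of "space M" "\<lambda>x. r * ?Y x" t]
        expectation_exp_centered(1)[of "s * r"]
      by (simp add: set_integrable_def set_integral_space mult.assoc
          cong: Bochner_Integration.integrable_cong)
    also have "\<dots> \<le> exp (- s * t) * exp (V * s\<^sup>2)"
      using expectation_exp_centered(2)[of "s * r"] that
      by (intro mult_left_mono) (simp_all add: mult.assoc power_mult_distrib)
    finally show ?thesis unfolding opt .
  qed
  have "prob {x \<in> space M. \<bar>?Y x\<bar> \<ge> t}
      \<le> prob ({x \<in> space M. 1 * ?Y x \<ge> t} \<union> {x \<in> space M. - 1 * ?Y x \<ge> t})"
    using X by (intro finite_measure_mono) auto
  also have "\<dots> \<le> prob {x \<in> space M. 1 * ?Y x \<ge> t} + prob {x \<in> space M. - 1 * ?Y x \<ge> t}"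
    using X by (intro measure_Un_le) auto
  also have "\<dots> \<le> 2 * exp (- (t\<^sup>2 / (4 * V)))"
    using ge[of 1] ge[of "- 1"] by simp
  finally show ?thesis .
qed

text \<open>Compare the second-order terms of \<open>E (cosh (s * (X - E X))) \<le> exp (V * s\<^sup>2)\<close> as \<open>s \<rightarrow> 0\<close>.\<close>

lemma subgaussian_variance: "variance X \<le> 2 * V"
proof -
  let ?Y = "\<lambda>x. X x - expectation X"
  have intY: "integrable M (\<lambda>x. (?Y x)\<^sup>2)"
  proof (rule integrable_const_bound)
    have "\<bar>?Y x\<bar> \<le> \<bar>B + \<bar>expectation X\<bar>\<bar>" for x
      using bounded[of x] by linarith
    then show "AE x in M. norm ((?Y x)\<^sup>2) \<le> (B + \<bar>expectation X\<bar>)\<^sup>2"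
      by (simp add: abs_le_square_iff)
  qed (use X in measurable)
  have le: "variance X \<le> 2 * ((exp (V * s\<^sup>2) - 1) / s\<^sup>2)" if s: "s \<noteq> 0" for s
  proof -
    have "1 + s\<^sup>2 / 2 * variance X = expectation (\<lambda>x. 1 + s\<^sup>2 / 2 * (?Y x)\<^sup>2)"
      using intY by (simp add: prob_space)
    \<comment> \<open>Averaging over \<open>s\<close> and \<open>- s\<close> cancels the odd terms,
      so the quadratic lower bound holds pointwise.\<close>
    also have "\<dots> \<le> expectation (\<lambda>x. (exp (s * ?Y x) + exp (- s * ?Y x)) / 2)"
    proof (rule integral_mono)
      fix x
      show "1 + s\<^sup>2 / 2 * (?Y x)\<^sup>2 \<le> (exp (s * ?Y x) + exp (- s * ?Y x)) / 2"
        using cosh_ge_quadratic[of "s * ?Y x"] by (simp add: cosh_def power_mult_distrib)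
    qed (use intY expectation_exp_centered(1)[of s] expectation_exp_centered(1)[of "- s"] in auto)
    also have "\<dots> = (expectation (\<lambda>x. exp (s * ?Y x)) + expectation (\<lambda>x. exp (- s * ?Y x))) / 2"
      using expectation_exp_centered(1)[of s] expectation_exp_centered(1)[of "- s"] by simp
    also have "\<dots> \<le> exp (V * s\<^sup>2)"
      using expectation_exp_centered(2)[of s] expectation_exp_centered(2)[of "- s"] by simp
    finally show ?thesis
      using s by (simp add: field_simps)
  qed
  have "((\<lambda>s. 2 * ((exp (V * s\<^sup>2) - 1) / s\<^sup>2)) \<longlongrightarrow> 2 * V) (at_right 0)"
    by real_asymp
  moreover have "\<forall>\<^sub>F s in at_right 0. variance X \<le> 2 * ((exp (V * s\<^sup>2) - 1) / s\<^sup>2)"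
    using eventually_at_right_less[of 0] by eventually_elim (rule le, simp)
  ultimately show ?thesis
    by (rule tendsto_lowerbound) simp
qed

end

end

section \<open>Concentration of the normalized empirical entropy\<close>

theorem theorem4p1:
  fixes \<theta> D \<alpha> t :: real
    and \<phi> :: "(nat \<Rightarrow> 'a::finite) \<Rightarrow> real"
    and \<mu> :: "(nat \<Rightarrow> 'a) measure"
    and n k :: nat
  assumes "CARD('a) \<ge> 2"
    and "0 < \<theta>" "\<theta> < 1"
    and "lipschitz_d_theta \<theta> \<phi>"
    and "is_gibbs_measure \<phi> \<mu>"
    and "D > 0"
    and "\<And>m K. m \<ge> 1 \<Longrightarrow> separately_lipschitz \<theta> m K \<Longrightarrow>
           (\<integral>x. exp (K (orbit_segment m x)) \<partial>\<mu>)
             \<le> exp (\<integral>y. K (orbit_segment m y) \<partial>\<mu>)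
               * exp (D * (\<Sum>i<m. (enn2real (Lip \<theta> m i K))\<^sup>2))"
    and "0 < \<alpha>" "\<alpha> < 1"
    and "t > 0"
    and "n \<ge> 2"
    and "k \<ge> 1"
    and "real k \<le> \<alpha> / (2 * ln (real CARD('a))) * ln (real n)"
  shows "let X = (\<lambda>x. empirical_entropy k (map x [0..<n]) / real k) in
      measure \<mu> {x \<in> space \<mu>. \<bar>X x - prob_space.expectation \<mu> X\<bar> \<ge> t}
        \<le> 2 * exp (- (real n powr (1 - \<alpha>) * t\<^sup>2 / (16 * D * (ln (real n))\<^sup>2))) \<and>
      prob_space.variance \<mu> X \<le> 8 * D * ((ln (real n))\<^sup>2 / real n powr (1 - \<alpha>))"
proof -
  interpret prob_space \<mu>
    using assms(5) by (simp add: is_gibbs_measure_def)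
  define E where "E ls = empirical_entropy k ls / real k" for ls :: "'a list"
  define X where "X x = E (map x [0..<n])" for x
  \<comment> \<open>\<open>L\<close> is the one-letter entropy bound after division by
    \<open>k\<close>; \<open>V\<close> is \<open>D\<close> times the sum of \<open>n\<close> squared
    constants \<open>L\<close>.\<close>
  define L where "L = 2 * ln (real n) / real n"
  define V where "V = D * (real n * L\<^sup>2)"
  have n: "real n > 0" "ln (real n) > 0" using \<open>n \<ge> 2\<close> by auto
  have L: "L > 0" and V: "V > 0" using n \<open>D > 0\<close> by (simp_all add: L_def V_def)
  have E_update: "\<bar>E ls - E (ls[j := a])\<bar> \<le> L" if "length ls = n" "j < n" for ls j a
  proof -
    have "\<bar>E ls - E (ls[j := a])\<bar>
        = \<bar>empirical_entropy k ls - empirical_entropy k (ls[j := a])\<bar> / real k"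
      by (simp add: E_def diff_divide_distrib[symmetric])
    also have "\<dots> \<le> (2 * real k * ln (real n) / real n) / real k"
      using empirical_entropy_update[of j ls k a] that by (intro divide_right_mono) auto
    also have "\<dots> = L"
      using \<open>k \<ge> 1\<close> by (simp add: L_def)
    finally show ?thesis .
  qed
  have mgf: "expectation (\<lambda>x. exp (s * X x)) \<le> exp (s * expectation X) * exp (V * s\<^sup>2)" for s
  proof -
    \<comment> \<open>The leading letters of the orbit segment of \<open>x\<close> spell its first
      \<open>n\<close> symbols, so \<open>K\<close> takes the value \<open>s * X x\<close> there.
      The factor \<open>s\<close> scales every Lipschitz constant by \<open>\<bar>s\<bar>\<close>,
      which produces \<open>s^2\<close> in the exponent.\<close>
    define K where "K xs = s * E (map (\<lambda>x. x 0) xs)" for xs :: "(nat \<Rightarrow> 'a) list"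
    have Lip_le: "Lip \<theta> n j K \<le> ennreal (\<bar>s\<bar> * L)" if "j < n" for j
      unfolding K_def using E_update that
      by (intro Lip_head_le)
        (simp_all add: right_diff_distrib[symmetric] abs_mult mult_left_mono)
    have "separately_lipschitz \<theta> n K"
      unfolding separately_lipschitz_def using Lip_le
      by (auto intro: le_less_trans[OF _ ennreal_less_top])
    then have "expectation (\<lambda>x. exp (K (orbit_segment n x)))
        \<le> exp (expectation (\<lambda>x. K (orbit_segment n x)))
          * exp (D * (\<Sum>i<n. (enn2real (Lip \<theta> n i K))\<^sup>2))"
      using assms(7)[of n K] \<open>n \<ge> 2\<close> by simp
    also have "\<dots> \<le> exp (expectation (\<lambda>x. K (orbit_segment n x))) * exp (V * s\<^sup>2)"
    proof -
      have "(\<Sum>i<n. (enn2real (Lip \<theta> n i K))\<^sup>2) \<le> (\<Sum>i<n. (\<bar>s\<bar> * L)\<^sup>2)"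
        using Lip_le L by (intro sum_mono power_mono enn2real_leI) auto
      also have "D * \<dots> = V * s\<^sup>2"
        by (simp add: V_def power_mult_distrib)
      finally show ?thesis
        using \<open>D > 0\<close> by (simp add: mult_left_mono)
    qed
    finally show ?thesis
      by (simp add: K_def map_head_orbit_segment X_def[abs_def])
  qed
  have meas: "X \<in> borel_measurable \<mu>"
    unfolding X_def using assms(5)
    by (intro measurable_compose[OF measurable_initial_word]) (auto simp: is_gibbs_measure_def)
  \<comment> \<open>\<open>X\<close> depends only on a word of length \<open>n\<close>, of which
    there are finitely many, so the maximum exists.\<close>
  define B where "B = Max ((\<lambda>ls. \<bar>E ls\<bar>) ` {ls. length ls = n})"
  have bounded: "\<bar>X x\<bar> \<le> B" for x
    unfolding X_def B_def using finite_lists_length_eq[of "UNIV :: 'a set" n]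
    by (intro Max_ge) auto
  have powr_le: "real n powr (1 - \<alpha>) \<le> real n"
    using powr_mono[of "1 - \<alpha>" 1 "real n"] \<open>0 < \<alpha>\<close> \<open>n \<ge> 2\<close> by simp
  \<comment> \<open>The 4 comes from squaring the 2 in \<open>L\<close>; then \<open>4 * V\<close>
    in the tail and \<open>2 * V\<close> in the variance give the constants 16 and 8.\<close>
  have V_eq: "V = 4 * D * (ln (real n))\<^sup>2 / real n"
    using n by (simp add: V_def L_def power2_eq_square)
  have "prob {x \<in> space \<mu>. \<bar>X x - expectation X\<bar> \<ge> t} \<le> 2 * exp (- (t\<^sup>2 / (4 * V)))"
    by (rule subgaussian_tail[OF meas bounded mgf V \<open>t > 0\<close>])
  also have "t\<^sup>2 / (4 * V) = real n * t\<^sup>2 / (16 * D * (ln (real n))\<^sup>2)"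
    using n \<open>D > 0\<close> by (simp add: V_eq ac_simps)
  also have "2 * exp (- \<dots>) \<le> 2 * exp (- (real n powr (1 - \<alpha>) * t\<^sup>2 / (16 * D * (ln (real n))\<^sup>2)))"
    using powr_le \<open>D > 0\<close> by (simp add: divide_right_mono mult_right_mono)
  finally have tail: "prob {x \<in> space \<mu>. \<bar>X x - expectation X\<bar> \<ge> t}
      \<le> 2 * exp (- (real n powr (1 - \<alpha>) * t\<^sup>2 / (16 * D * (ln (real n))\<^sup>2)))" .
  have "variance X \<le> 2 * V"
    by (rule subgaussian_variance[OF meas bounded mgf])
  also have "\<dots> = 8 * D * ((ln (real n))\<^sup>2 / real n)"
    by (simp add: V_eq)
  also have "\<dots> \<le> 8 * D * ((ln (real n))\<^sup>2 / real n powr (1 - \<alpha>))"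
    using powr_le n \<open>D > 0\<close> by (intro mult_left_mono divide_left_mono) auto
  finally have "variance X \<le> 8 * D * ((ln (real n))\<^sup>2 / real n powr (1 - \<alpha>))" .
  with tail show ?thesis
    by (simp add: X_def[abs_def] E_def Let_def)
qed

end
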